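(* Let $k\ge2$ and let $x$ be an irrational real number whose continued fraction expansion $[a_0,a_1,a_2,\ldots]$ is $k$-automatic. Then the continued fraction expansions of both $\liminf_{n\to\infty}T^n(x)$ and $\limsup_{n\to\infty}T^n(x)$ are $k$-automatic.
   Context: A continued fraction expansion $[a_0,a_1,\ldots]$ is called $k$-automatic if its partial quotients are bounded and the sequence $(a_i)_{i\ge0}$ (over the finite set of values taken) is $k$-automatic, i.e., there is a deterministic finite automaton with output $M=(Q,\{0,\ldots,k-1\},\Delta,\delta,q_0,\tau)$ with $a_n=\tau(\delta(q_0,w^R))$ for every base-$k$ representation $w$ of $n$ (leading zeros allowed), $w^R$ the reversal of $w$. $T$ is the Gauss-type map $T(y)=1/(y-\lfloor y\rfloor)$, so that $T([a_0,a_1,a_2,\ldots])=[a_1,a_2,\ldots]$. *)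

theory Defs
  imports Complex_Main "HOL-Library.Extended_Real"
begin

record ('q, 'o) dfao =
  states :: "'q set"
  alphabet :: "'o set"
  trans :: "'q \<Rightarrow> nat \<Rightarrow> 'q"
  init :: "'q"
  out :: "'q \<Rightarrow> 'o"

text \<open>The input alphabet is \<open>{0, \<dots>, k - 1}\<close>; \<open>alphabet\<close> is the output alphabet.\<close>

definition is_dfao :: "nat \<Rightarrow> ('q, 'o) dfao \<Rightarrow> bool" where
  "is_dfao k M \<longleftrightarrow>
     finite (states M) \<and> finite (alphabet M) \<and> init M \<in> states M \<and>
     (\<forall>q\<in>states M. \<forall>d<k. trans M q d \<in> states M) \<and>
     (\<forall>q\<in>states M. out M q \<in> alphabet M)"

definition run :: "('q, 'o) dfao \<Rightarrow> nat list \<Rightarrow> 'q" where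
  "run M w = foldl (trans M) (init M) w"

text \<open>Words are written with the most significant digit first, whereas \<open>horner_sum\<close> expects
  the least significant digit first. Leading zeros are allowed, and the empty word
  represents \<open>0\<close>.\<close>

definition represents :: "nat \<Rightarrow> nat list \<Rightarrow> nat \<Rightarrow> bool" where
  "represents k w n \<longleftrightarrow> set w \<subseteq> {..<k} \<and> horner_sum id k (rev w) = n"

text \<open>Taking the states to be natural numbers is no restriction, since the state set is finite.\<close>

definition automatic :: "nat \<Rightarrow> (nat \<Rightarrow> 'o) \<Rightarrow> bool" where
  "automatic k a \<longleftrightarrow>
     (\<exists>M :: (nat, 'o) dfao. is_dfao k M \<and>
        (\<forall>n w. represents k w n \<longrightarrow> a n = out M (run M (rev w))))"

fun cf_convergent :: "(nat \<Rightarrow> int) \<Rightarrow> nat \<Rightarrow> real" where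
  "cf_convergent a 0 = of_int (a 0)"
| "cf_convergent a (Suc n) = of_int (a 0) + 1 / cf_convergent (\<lambda>i. a (Suc i)) n"

text \<open>\<open>cf_expansion y a\<close> says that \<open>y = [a\<^sub>0, a\<^sub>1, a\<^sub>2, \<dots>]\<close> is an infinite simple
  continued fraction; such an expansion exists, and is then unique, exactly when \<open>y\<close> is
  irrational.\<close>

definition cf_expansion :: "real \<Rightarrow> (nat \<Rightarrow> int) \<Rightarrow> bool" where
  "cf_expansion y a \<longleftrightarrow> (\<forall>i\<ge>1. a i \<ge> 1) \<and> cf_convergent a \<longlonglongrightarrow> y"

definition automatic_cf :: "nat \<Rightarrow> (nat \<Rightarrow> int) \<Rightarrow> bool" where
  "automatic_cf k a \<longleftrightarrow> (\<exists>B. \<forall>i. \<bar>a i\<bar> \<le> B) \<and> automatic k a"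

definition gauss_map :: "real \<Rightarrow> real" where
  "gauss_map y = 1 / (y - of_int \<lfloor>y\<rfloor>)"

end

theory Submission
  imports Defs
begin

text \<open>
  Continued fractions are ordered by the alternating lexicographic order of their digits, so the
  lower limit of the orbit of \<open>x\<close> has as its expansion the least sequence \<open>b\<close> of which every
  prefix occurs infinitely often in \<open>a\<close>; the upper limit is obtained from the reversed order.
  The digit \<open>b i\<close> is definable from \<open>a\<close>: it is the \<open>c\<close> such that infinitely many \<open>n\<close> satisfy
  \<open>a (n + i) = c\<close> and have only finitely many \<open>m\<close> whose window of length \<open>i + 1\<close> is smaller
  than the one at \<open>n\<close>. A sequence is automatic iff its kernel is finite, and finiteness of
  kernels, for functions of several variables, is preserved by Boolean operations and by the
  quantifiers ``there exist'' and ``there exist infinitely many''.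
\<close>

section \<open>Finite kernels\<close>

text \<open>Variables are coordinates of an assignment \<open>v\<close>, so that quantifying over
  one of them is an update \<open>v(x := m)\<close>. All coordinates are scaled by the same power,
  as for words read in parallel, but have independent residues.\<close>

definition kernel :: "nat \<Rightarrow> ((nat \<Rightarrow> nat) \<Rightarrow> 'o) \<Rightarrow> ((nat \<Rightarrow> nat) \<Rightarrow> 'o) set" where
  "kernel k P = {Q. \<exists>e r. (\<forall>i. r i < k ^ e) \<and> Q = (\<lambda>v. P (\<lambda>i. k ^ e * v i + r i))}"

definition finite_kernel :: "nat \<Rightarrow> ((nat \<Rightarrow> nat) \<Rightarrow> 'o) \<Rightarrow> bool" where
  "finite_kernel k P \<longleftrightarrow> finite (kernel k P)"

lemma finite_kernelI:
  assumes "finite S"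
    and "\<And>e r. (\<And>i. r i < k ^ e) \<Longrightarrow> (\<lambda>v. P (\<lambda>i. k ^ e * v i + r i)) \<in> S"
  shows "finite_kernel k P"
proof -
  have "kernel k P \<subseteq> S"
    using assms(2) by (auto simp: kernel_def)
  thus ?thesis
    using assms(1) finite_subset unfolding finite_kernel_def by blast
qed

lemma kernelI: "(\<And>i. r i < k ^ e) \<Longrightarrow> (\<lambda>v. P (\<lambda>i. k ^ e * v i + r i)) \<in> kernel k P"
  by (auto simp: kernel_def)

section \<open>Closure under pointwise operations and quantifiers\<close>

lemma finite_kernel_map2:
  assumes "finite_kernel k P" "finite_kernel k Q"
  shows "finite_kernel k (\<lambda>v. f (P v) (Q v))"
proof (rule finite_kernelI)
  show "finite ((\<lambda>(P', Q'). \<lambda>v. f (P' v) (Q' v)) ` (kernel k P \<times> kernel k Q))"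
    using assms by (simp add: finite_kernel_def)
  fix e and r :: "nat \<Rightarrow> nat" assume r: "\<And>i. r i < k ^ e"
  show "(\<lambda>v. f (P (\<lambda>i. k ^ e * v i + r i)) (Q (\<lambda>i. k ^ e * v i + r i)))
     \<in> (\<lambda>(P', Q'). \<lambda>v. f (P' v) (Q' v)) ` (kernel k P \<times> kernel k Q)"
    \<comment> \<open>The same \<open>e\<close> and \<open>r\<close> act on both arguments, so each
      element comes from a pair of kernel elements.\<close>
    by (rule image_eqI[where x = "(\<lambda>v. P (\<lambda>i. k ^ e * v i + r i), \<lambda>v. Q (\<lambda>i. k ^ e * v i + r i))"])
       (auto intro!: kernelI r)
qed

lemma finite_kernel_map: "finite_kernel k P \<Longrightarrow> finite_kernel k (\<lambda>v. f (P v))"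
  by (rule finite_kernel_map2[where f = "\<lambda>p _. f p"])

text \<open>A quantifier \<open>q\<close> that splits along residue classes turns each kernel element of the
  quantified function into a union, over a subset of the finite kernel of \<open>P\<close>, of quantified
  functions.\<close>

lemma finite_kernel_quantifier:
  fixes q :: "(nat \<Rightarrow> 'o) \<Rightarrow> 'c set"
  assumes P: "finite_kernel k P"
    and q: "\<And>e f. q f = (\<Union>s<k ^ e. q (\<lambda>m. f (k ^ e * m + s)))"
  shows "finite_kernel k (\<lambda>v. q (\<lambda>m. P (v(x := m))))"
proof (rule finite_kernelI)
  show "finite ((\<lambda>S v. \<Union>K\<in>S. q (\<lambda>m. K (v(x := m)))) ` Pow (kernel k P))"
    using P by (simp add: finite_kernel_def)
  fix e and r :: "nat \<Rightarrow> nat" assume r: "\<And>i. r i < k ^ e"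
  define K where "K s = (\<lambda>v. P (\<lambda>i. k ^ e * v i + (r(x := s)) i))" for s
  have upd: "(\<lambda>i. k ^ e * v i + r i)(x := k ^ e * m + s) =
      (\<lambda>i. k ^ e * (v(x := m)) i + (r(x := s)) i)" for v m s
    by auto
  have "q (\<lambda>m. P ((\<lambda>i. k ^ e * v i + r i)(x := m))) =
        (\<Union>L\<in>K ` {..<k ^ e}. q (\<lambda>m. L (v(x := m))))" for v
    by (subst q[of _ e]) (simp add: K_def upd del: fun_upd_apply)
  moreover have "K ` {..<k ^ e} \<in> Pow (kernel k P)"
    using r by (auto simp: K_def intro!: kernelI)
  ultimately show "(\<lambda>v. q (\<lambda>m. P ((\<lambda>i. k ^ e * v i + r i)(x := m))))
      \<in> (\<lambda>S v. \<Union>K\<in>S. q (\<lambda>m. K (v(x := m)))) ` Pow (kernel k P)"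
    by (intro image_eqI[where x = "K ` {..<k ^ e}"]) auto
qed

lemma residue_split:
  fixes k :: nat
  assumes "k > 0"
  shows "\<exists>s<k ^ e. \<exists>m. n = k ^ e * m + s"
  by (rule exI[of _ "n mod k ^ e"]) (use assms in \<open>auto intro!: exI[of _ "n div k ^ e"]\<close>)

text \<open>The range of truth values splits along residue classes, and existence says that this
  range contains \<open>True\<close>.\<close>

lemma finite_kernel_Ex:
  assumes "k > 0" "finite_kernel k P"
  shows "finite_kernel k (\<lambda>v. \<exists>m. P (v(x := m)))"
proof -
  have "finite_kernel k (\<lambda>v. range (\<lambda>m. P (v(x := m))))"
  proof (rule finite_kernel_quantifier[OF assms(2)])
    show "range f = (\<Union>s<k ^ e. range (\<lambda>m. f (k ^ e * m + s)))" for e and f :: "nat \<Rightarrow> bool"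
    proof (intro equalityI subsetI)
      fix c assume "c \<in> range f"
      then obtain n where "c = f n" by blast
      with residue_split[OF assms(1), of e n] show "c \<in> (\<Union>s<k ^ e. range (\<lambda>m. f (k ^ e * m + s)))"
        by auto
    qed auto
  qed
  from finite_kernel_map[OF this, of "\<lambda>A. True \<in> A"] show ?thesis
    by (simp add: image_iff eq_commute)
qed

text \<open>Pigeonhole: there are finitely many residue classes, and \<open>m\<close> determines
  \<open>k ^ e * m + s\<close> injectively.\<close>

lemma infinite_residue_split:
  fixes f :: "nat \<Rightarrow> 'o" and k :: nat
  assumes "k > 0"
  shows "infinite {m. f m = c} \<longleftrightarrow> (\<exists>s<k ^ e. infinite {m. f (k ^ e * m + s) = c})"
proof -
  have "{m. f m = c} = (\<Union>s<k ^ e. (\<lambda>m. k ^ e * m + s) ` {m. f (k ^ e * m + s) = c})"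
    using residue_split[OF assms, of e] by (fastforce simp: image_iff)
  moreover have "finite ((\<lambda>m. k ^ e * m + s) ` A) \<longleftrightarrow> finite A" for A and s :: nat
    by (rule finite_image_iff) (use assms in \<open>auto simp: inj_on_def\<close>)
  ultimately show ?thesis by auto
qed

lemma finite_kernel_recurrent_values:
  assumes "k > 0" "finite_kernel k P"
  shows "finite_kernel k (\<lambda>v. {c. infinite {m. P (v(x := m)) = c}})"
proof (rule finite_kernel_quantifier[OF assms(2), where q = "\<lambda>f. {c. infinite {m. f m = c}}"])
  show "{c. infinite {m. f m = c}} = (\<Union>s<k ^ e. {c. infinite {m. f (k ^ e * m + s) = c}})"
    for e and f :: "nat \<Rightarrow> 'a"
    by (subst infinite_residue_split[OF assms(1), of _ _ e]) auto
qed

lemma finite_kernel_finite: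
  assumes "k > 0" "finite_kernel k P"
  shows "finite_kernel k (\<lambda>v. finite {m. P (v(x := m))})"
  using finite_kernel_map[OF finite_kernel_recurrent_values[OF assms], of "\<lambda>A. True \<notin> A"]
  by simp

section \<open>Atomic predicates: order and parity\<close>

lemma finite_kernel_less: "finite_kernel k (\<lambda>v. v x < v y)"
proof (rule finite_kernelI)
  show "finite {\<lambda>v::nat \<Rightarrow> nat. v x < v y, \<lambda>v. v x \<le> v y}" by simp
  fix e and r :: "nat \<Rightarrow> nat" assume r: "\<And>i. r i < k ^ e"
  have lt: "k ^ e * p + r i < k ^ e * q + r j" if "p < q" for p q i j
  proof -
    have "k ^ e * p + r i < k ^ e * Suc p" using r[of i] by simp
    also have "\<dots> \<le> k ^ e * q" using that by (intro mult_left_mono) auto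
    finally show ?thesis by simp
  qed
  \<comment> \<open>The quotients decide the comparison unless they are equal; then the residues do.
    Only the strict and the weak order can arise.\<close>
  have "k ^ e * p + r x < k ^ e * q + r y \<longleftrightarrow> (if r x < r y then p \<le> q else p < q)" for p q
    using lt[of p q x y] lt[of q p y x] by (cases p q rule: linorder_cases) auto
  thus "(\<lambda>v. k ^ e * v x + r x < k ^ e * v y + r y)
      \<in> {\<lambda>v. v x < v y, \<lambda>v. v x \<le> v y}"
    by auto
qed

lemma finite_kernel_even: "finite_kernel k (\<lambda>v. even (v x))"
proof (rule finite_kernelI)
  show "finite ((\<lambda>(p, q) v. even (v x) \<and> p \<longleftrightarrow> q) ` (UNIV :: (bool \<times> bool) set))"
    by simp
  show "(\<lambda>v. even (k ^ e * v x + r x)) \<in> (\<lambda>(p, q) v. even (v x) \<and> p \<longleftrightarrow> q) ` UNIV" for e r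
    \<comment> \<open>For odd \<open>k ^ e\<close> the parities of \<open>v x\<close> and
      \<open>r x\<close> are compared. For even \<open>k ^ e\<close> the first conjunction is false
      and the predicate is the constant \<open>\<not> q\<close>, hence the negated choice of
      \<open>q\<close>.\<close>
    by (rule image_eqI[where x = "(odd (k ^ e), if odd (k ^ e) then even (r x) else odd (r x))"])
       (auto simp: fun_eq_iff)
qed

section \<open>Automatic sequences and finite kernels\<close>

lemma digits_exist:
  fixes k :: nat
  assumes "k > 0" "r < k ^ e"
  shows "\<exists>w. set w \<subseteq> {..<k} \<and> length w = e \<and> horner_sum id k w = r"
  using assms(2)
proof (induction e arbitrary: r)
  case (Suc e)
  have "r div k < k ^ e"
    using Suc.prems assms(1) by (simp add: less_mult_imp_div_less mult.commute)
  from Suc.IH[OF this] obtain w where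
    "set w \<subseteq> {..<k}" "length w = e" "horner_sum id k w = r div k" by blast
  moreover have "id (r mod k) + k * (r div k) = r" by simp
  ultimately show ?case
    using assms(1) by (intro exI[of _ "(r mod k) # w"]) (auto simp del: id_apply)
qed simp

text \<open>The automaton reads low digits first. After the \<open>e\<close> digits of
  \<open>r\<close>, padded with zeros, only the state reached matters for the remaining digits
  \<open>n\<close>, so there are at most as many kernel elements as states.\<close>

lemma automatic_imp_finite_kernel_seq:
  assumes "k \<ge> 2" "automatic k a"
  shows "finite {f. \<exists>e r. r < k ^ e \<and> f = (\<lambda>n. a (k ^ e * n + r))}"
proof -
  obtain M :: "(nat, 'a) dfao" where M: "is_dfao k M"
    and a: "\<And>n w. represents k w n \<Longrightarrow> a n = out M (run M (rev w))"
    using assms(2) unfolding automatic_def by blast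
  have "\<exists>w. set w \<subseteq> {..<k} \<and> horner_sum id k w = n" for n
  proof -
    have "n < k ^ n" using assms(1) by (simp add: power_gt_expt)
    thus ?thesis using digits_exist[of k n n] assms(1) by auto
  qed
  then obtain d where d: "\<And>n. set (d n) \<subseteq> {..<k}" "\<And>n. horner_sum id k (d n) = n"
    by metis
  have run_states: "foldl (trans M) q w \<in> states M" if "q \<in> states M" "set w \<subseteq> {..<k}" for q w
    using that M by (induction w arbitrary: q) (auto simp: is_dfao_def)
  have "{f. \<exists>e r. r < k ^ e \<and> f = (\<lambda>n. a (k ^ e * n + r))}
      \<subseteq> (\<lambda>q n. out M (foldl (trans M) q (d n))) ` states M"
  proof clarify
    fix e r assume "r < k ^ e"
    then obtain w where w: "set w \<subseteq> {..<k}" "length w = e" "horner_sum id k w = r"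
      using digits_exist[of k r e] assms(1) by auto
    have "a (k ^ e * n + r) = out M (foldl (trans M) (run M w) (d n))" for n
    proof -
      have "represents k (rev (w @ d n)) (k ^ e * n + r)"
        using w d[of n] by (auto simp: represents_def horner_sum_append)
      from a[OF this] show ?thesis by (simp add: run_def)
    qed
    moreover have "run M w \<in> states M"
      using run_states[of "init M" w] w M by (auto simp: is_dfao_def run_def)
    ultimately show "(\<lambda>n. a (k ^ e * n + r)) \<in> (\<lambda>q n. out M (foldl (trans M) q (d n))) ` states M"
      by auto
  qed
  thus ?thesis
    using M finite_subset unfolding is_dfao_def by blast
qed

text \<open>Adding two residues below \<open>k ^ e\<close> leaves a residue and a carry
  \<open>c\<close> of 0 or 1, which is passed on to the sum of the quotients.\<close>

lemma finite_kernel_automatic_sum: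
  assumes "k \<ge> 2" "automatic k a"
  shows "finite_kernel k (\<lambda>v. a (v x + v y))"
proof (rule finite_kernelI)
  define S where "S = {f. \<exists>e r. r < k ^ e \<and> f = (\<lambda>n. a (k ^ e * n + r))}"
  show "finite ((\<lambda>(f, c) v. f (v x + v y + c)) ` (S \<times> {0, 1}))"
    using automatic_imp_finite_kernel_seq[OF assms] by (simp add: S_def)
  fix e and r :: "nat \<Rightarrow> nat" assume r: "\<And>i. r i < k ^ e"
  show "(\<lambda>v. a (k ^ e * v x + r x + (k ^ e * v y + r y)))
      \<in> (\<lambda>(f, c) v. f (v x + v y + c)) ` (S \<times> {0, 1})"
  proof (cases "r x + r y < k ^ e")
    case True
    have eq: "k ^ e * p + r x + (k ^ e * q + r y) = k ^ e * (p + q) + (r x + r y)" for p q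
      by (simp add: algebra_simps)
    have "(\<lambda>n. a (k ^ e * n + (r x + r y))) \<in> S"
      using True by (auto simp: S_def)
    thus ?thesis
      by (intro image_eqI[where x = "(\<lambda>n. a (k ^ e * n + (r x + r y)), 0)"]) (simp_all add: eq)
  next
    case False
    define t where "t = r x + r y - k ^ e"
    have t: "t < k ^ e" "r x + r y = k ^ e + t"
      using False r[of x] r[of y] by (auto simp: t_def)
    have "k ^ e * p + r x + (k ^ e * q + r y) = k ^ e * (p + q + 1) + t" for p q
      using t(2) by (simp add: algebra_simps)
    thus ?thesis
      by (intro image_eqI[where x = "(\<lambda>n. a (k ^ e * n + t), 1)"])
         (use t(1) in \<open>auto simp: S_def\<close>)
  qed
qed

text \<open>The kernel elements serve as states: reading \<open>d\<close> sends \<open>f\<close> to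
  its subsequence at \<open>k * n + d\<close>, and the output is \<open>f 0\<close>.\<close>

lemma finite_kernel_imp_automatic:
  assumes "finite_kernel k (\<lambda>v. b (v x))"
  shows "automatic k b"
proof -
  define S where "S = {f. \<exists>e r. r < k ^ e \<and> f = (\<lambda>n. b (k ^ e * n + r))}"
  \<comment> \<open>A constant assignment and the same residue in every coordinate recover the
    kernel of the sequence \<open>b\<close>.\<close>
  have "S \<subseteq> (\<lambda>K n. K (\<lambda>_. n)) ` kernel k (\<lambda>v. b (v x))"
  proof
    fix f assume "f \<in> S"
    then obtain e r where r: "r < k ^ e" and f: "f = (\<lambda>n. b (k ^ e * n + r))"
      by (auto simp: S_def)
    show "f \<in> (\<lambda>K n. K (\<lambda>_. n)) ` kernel k (\<lambda>v. b (v x))"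
      by (rule image_eqI[OF _ kernelI[of "\<lambda>_. r" k e]]) (simp_all add: r f)
  qed
  hence fin: "finite S"
    using assms finite_subset unfolding finite_kernel_def by blast
  \<comment> \<open>States have to be natural numbers, so kernel elements are encoded by
    \<open>h\<close> and decoded by \<open>g\<close>.\<close>
  obtain h :: "(nat \<Rightarrow> 'a) \<Rightarrow> nat" where h: "inj_on h S"
    using finite_imp_inj_to_nat_seg[OF fin] by auto
  define g where "g = inv_into S h"
  have gh: "g (h f) = f" if "f \<in> S" for f
    using that h by (simp add: g_def)
  have S_step: "(\<lambda>n. f (k * n + d)) \<in> S" if f: "f \<in> S" and d: "d < k" for f d
  proof -
    obtain e r where r: "r < k ^ e" and f: "f = (\<lambda>n. b (k ^ e * n + r))"
      using f by (auto simp: S_def)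
    have "k ^ e * d + r < k ^ e * Suc d" using r by simp
    also have "\<dots> \<le> k ^ e * k" using d by (intro mult_left_mono) auto
    finally show ?thesis
      unfolding S_def f
      by (intro CollectI exI[of _ "Suc e"] exI[of _ "k ^ e * d + r"]) (auto simp: algebra_simps)
  qed
  have b: "b \<in> S"
    unfolding S_def by (intro CollectI exI[of _ 0] exI[of _ 0]) auto
  define M :: "(nat, 'a) dfao" where
    "M = \<lparr>states = h ` S, alphabet = (\<lambda>f. f 0) ` S, trans = (\<lambda>q d. h (\<lambda>n. g q (k * n + d))),
          init = h b, out = (\<lambda>q. g q 0)\<rparr>"
  have "is_dfao k M"
    using fin b S_step by (auto simp: is_dfao_def M_def gh)
  moreover have "out M (foldl (trans M) (h f) w) = f (horner_sum id k w)"
    if "f \<in> S" "set w \<subseteq> {..<k}" for f w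
    using that
  proof (induction w arbitrary: f)
    case (Cons d w)
    thus ?case
      using Cons.IH[OF S_step[of f d]] by (simp add: M_def gh add.commute)
  qed (simp add: M_def gh)
  hence "b n = out M (run M (rev w))" if "represents k w n" for n w
    using that b by (auto simp: represents_def run_def M_def)
  ultimately show ?thesis
    unfolding automatic_def by blast
qed

section \<open>The extremal sequence\<close>

text \<open>The sign of the comparison at digit \<open>i\<close>: \<open>s = 1\<close> gives the alternating lexicographic
  order and \<open>s = -1\<close> its reverse.\<close>

definition alt :: "int \<Rightarrow> nat \<Rightarrow> int" where
  "alt s i = (if even i then s else - s)"

text \<open>Phrased with \<open>\<exists>\<close>, \<open>\<not>\<close> and \<open><\<close> only, for which the kernel is known to stay finite.\<close>

definition window_less :: "int \<Rightarrow> (nat \<Rightarrow> int) \<Rightarrow> nat \<Rightarrow> nat \<Rightarrow> nat \<Rightarrow> bool" where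
  "window_less s a i m n \<longleftrightarrow> (\<exists>j. \<not> i < j \<and> \<not> (\<exists>j'. j' < j \<and> a (m + j') \<noteq> a (n + j')) \<and>
     alt s j * a (m + j) < alt s j * a (n + j))"

text \<open>Minimality is stated digit by digit: after the first \<open>i\<close> digits of
  \<open>b\<close>, any digit below \<open>b i\<close> follows only finitely often.\<close>

definition least_recurrent :: "int \<Rightarrow> (nat \<Rightarrow> int) \<Rightarrow> (nat \<Rightarrow> int) \<Rightarrow> bool" where
  "least_recurrent s a b \<longleftrightarrow>
     (\<forall>i. infinite {n. \<forall>j<i. a (n + j) = b j}) \<and>
     (\<forall>i. finite {n. (\<forall>j<i. a (n + j) = b j) \<and> alt s i * a (n + i) < alt s i * b i})"

text \<open>Greedy choice: among the finitely many digits that follow the current prefix infinitely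
  often, take the least in the order of that position.\<close>

lemma least_recurrent_exists:
  assumes "finite (range a)"
  shows "\<exists>b. least_recurrent s a b"
proof -
  have step: "\<exists>c. infinite {n\<in>N. a (n + i) = c} \<and> finite {n\<in>N. alt s i * a (n + i) < alt s i * c}"
    if N: "infinite N" for N i
  proof -
    define C where "C = {c\<in>range a. infinite {n\<in>N. a (n + i) = c}}"
    have "finite C" using assms by (simp add: C_def)
    moreover have "C \<noteq> {}"
    proof
      assume "C = {}"
      hence "finite (\<Union>c\<in>range a. {n\<in>N. a (n + i) = c})"
        using assms by (intro finite_UN_I) (auto simp: C_def)
      moreover have "N = (\<Union>c\<in>range a. {n\<in>N. a (n + i) = c})" by auto
      ultimately show False using N by simp
    qed
    ultimately obtain c where c: "c \<in> C" "\<And>c'. c' \<in> C \<Longrightarrow> \<not> alt s i * c' < alt s i * c"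
      using ex_is_arg_min_if_finite[of C "\<lambda>c. alt s i * c"] unfolding is_arg_min_def by blast
    have "{n\<in>N. alt s i * a (n + i) < alt s i * c} \<subseteq> (\<Union>c'\<in>range a - C. {n\<in>N. a (n + i) = c'})"
      using c(2) by blast
    moreover have "finite \<dots>"
      using assms by (intro finite_UN_I) (auto simp: C_def)
    ultimately show ?thesis
      using c(1) finite_subset unfolding C_def by blast
  qed
  define good where "good N i c \<longleftrightarrow> infinite {n\<in>N. a (n + i) = c} \<and>
    finite {n\<in>N. alt s i * a (n + i) < alt s i * c}" for N i c
  \<comment> \<open>Dependent choice builds the sets \<open>N i\<close> of positions matching the
    first \<open>i\<close> digits; the digits themselves are extracted afterwards.\<close>
  have "\<exists>N. \<forall>i. (infinite (N i) \<and> (i = 0 \<longrightarrow> N i = UNIV)) \<and>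
    (\<exists>c. N (Suc i) = {n\<in>N i. a (n + i) = c} \<and> good (N i) i c)"
  proof (rule dependent_nat_choice)
    fix N :: "nat set" and i :: nat
    assume "infinite N \<and> (i = 0 \<longrightarrow> N = UNIV)"
    then obtain c where c: "good N i c" using step good_def by blast
    show "\<exists>N'. (infinite N' \<and> (Suc i = 0 \<longrightarrow> N' = UNIV)) \<and>
      (\<exists>c. N' = {n\<in>N. a (n + i) = c} \<and> good N i c)"
      by (rule exI[of _ "{n\<in>N. a (n + i) = c}"]) (use c in \<open>auto simp: good_def\<close>)
  qed auto
  then obtain N where "\<forall>i. (infinite (N i) \<and> (i = 0 \<longrightarrow> N i = UNIV)) \<and>
    (\<exists>c. N (Suc i) = {n\<in>N i. a (n + i) = c} \<and> good (N i) i c)" ..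
  hence N: "\<And>i. infinite (N i)" "N 0 = UNIV"
    and ex: "\<forall>i. \<exists>c. N (Suc i) = {n\<in>N i. a (n + i) = c} \<and> good (N i) i c"
    by simp_all
  from choice[OF ex] obtain b where b: "\<And>i. N (Suc i) = {n\<in>N i. a (n + i) = b i}"
    "\<And>i. finite {n\<in>N i. alt s i * a (n + i) < alt s i * b i}"
    unfolding good_def by auto
  have "N i = {n. \<forall>j<i. a (n + j) = b j}" for i
    by (induction i) (auto simp: N(2) b(1) less_Suc_eq)
  with N b(2) show ?thesis
    unfolding least_recurrent_def by (intro exI[of _ b]) auto
qed

text \<open>Transfers bounds and positivity of the digits from \<open>a\<close> to
  \<open>b\<close>.\<close>

lemma least_recurrent_digit_recurs:
  assumes "least_recurrent s a b"
  shows "infinite {n. a n = b i}"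
proof
  assume "finite {n. a n = b i}"
  hence "finite ((\<lambda>n. n + i) -` {n. a n = b i})"
    by (rule finite_vimageI) simp
  moreover have "{n. \<forall>j<Suc i. a (n + j) = b j} \<subseteq> (\<lambda>n. n + i) -` {n. a n = b i}"
    by auto
  ultimately show False
    using assms finite_subset unfolding least_recurrent_def by blast
qed

lemma least_recurrent_eventually:
  assumes "least_recurrent s a b"
  shows "finite {n. \<exists>j\<le>i. (\<forall>j'<j. a (n + j') = b j') \<and> alt s j * a (n + j) < alt s j * b j}"
proof -
  have "finite (\<Union>j\<in>{..i}. {n. (\<forall>j'<j. a (n + j') = b j') \<and> alt s j * a (n + j) < alt s j * b j})"
    using assms by (intro finite_UN_I) (auto simp: least_recurrent_def)
  thus ?thesis by (rule rev_finite_subset) auto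
qed

text \<open>Defines \<open>b i\<close> from \<open>a\<close> alone, in the form of a set of
  recurrent values. \<open>None\<close> marks the positions that have infinitely many smaller
  windows.\<close>

lemma least_recurrent_digit:
  assumes lr: "least_recurrent s a b" and s: "s \<noteq> 0"
  shows "{c. infinite {n. (if finite {m. window_less s a i m n} then Some (a (n + i)) else None) = Some c}}
    = {b i}" (is "?L = _")
proof
  have good: "finite {m. window_less s a i m n}" if "\<forall>j<Suc i. a (n + j) = b j" for n
  proof (rule finite_subset[OF _ least_recurrent_eventually[OF lr, of i]])
    show "{m. window_less s a i m n}
      \<subseteq> {n. \<exists>j\<le>i. (\<forall>j'<j. a (n + j') = b j') \<and> alt s j * a (n + j) < alt s j * b j}"
    proof clarify
      fix m assume "window_less s a i m n"
      then obtain j where j: "j \<le> i" "\<forall>j'<j. a (m + j') = a (n + j')"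
        "alt s j * a (m + j) < alt s j * a (n + j)"
        unfolding window_less_def by (meson not_le_imp_less)
      hence "\<forall>j'<j. a (m + j') = b j'" "a (n + j) = b j" using that by auto
      with j show "\<exists>j\<le>i. (\<forall>j'<j. a (m + j') = b j') \<and> alt s j * a (m + j) < alt s j * b j"
        by metis
    qed
  qed
  have "{n. \<forall>j<Suc i. a (n + j) = b j}
    \<subseteq> {n. (if finite {m. window_less s a i m n} then Some (a (n + i)) else None) = Some (b i)}"
    using good by auto
  moreover have "infinite {n. \<forall>j<Suc i. a (n + j) = b j}"
    using lr unfolding least_recurrent_def by blast
  ultimately show "{b i} \<subseteq> ?L"
    using finite_subset by blast
  show "?L \<subseteq> {b i}"
  proof clarify
    fix c
    assume "infinite {n. (if finite {m. window_less s a i m n} then Some (a (n + i)) else None) = Some c}"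
    \<comment> \<open>Among infinitely many candidates, one lies outside the finite set of positions
      whose window is below the prefix of \<open>b\<close>.\<close>
    from infinite_imp_nonempty[OF Diff_infinite_finite[OF least_recurrent_eventually[OF lr, of i] this]]
    obtain n where "(if finite {m. window_less s a i m n} then Some (a (n + i)) else None) = Some c"
      and min: "\<not> (\<exists>j\<le>i. (\<forall>j'<j. a (n + j') = b j') \<and> alt s j * a (n + j) < alt s j * b j)"
      by blast
    hence n: "finite {m. window_less s a i m n}" "a (n + i) = c"
      by (auto split: if_splits)
    have "a (n + j) = b j" if "j \<le> i" for j
      using that
    proof (induction j rule: less_induct)
      case (less j)
      hence pre: "\<forall>j'<j. a (n + j') = b j'" by simp
      show ?case
      proof (rule ccontr)
        assume neq: "a (n + j) \<noteq> b j"
        have "alt s j \<noteq> 0" using s by (simp add: alt_def)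
        hence "alt s j * b j < alt s j * a (n + j)"
          using min pre less.prems neq by (metis linorder_neqE mult_left_cancel)
        \<comment> \<open>At the first disagreement the digit at \<open>n\<close> is the larger one,
          so each of the infinitely many occurrences of the prefix of \<open>b\<close> gives a
          smaller window.\<close>
        hence "{m. \<forall>j'<Suc j. a (m + j') = b j'} \<subseteq> {m. window_less s a i m n}"
          using pre less.prems by (auto simp: window_less_def intro!: exI[of _ j])
        moreover have "infinite {m. \<forall>j'<Suc j. a (m + j') = b j'}"
          using lr unfolding least_recurrent_def by blast
        ultimately show False using n(1) finite_subset by blast
      qed
    qed
    thus "c = b i" using n(2) by auto
  qed
qed

lemma automatic_least_recurrent:
  assumes k: "k \<ge> 2" and a: "automatic k a" and lr: "least_recurrent s a b" and s: "s \<noteq> 0"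
  shows "automatic k b"
proof -
  have k0: "k > 0" using k by simp
  note sum = finite_kernel_automatic_sum[OF k a]
  note map2 = finite_kernel_map2
  \<comment> \<open>The coordinates 0, 1, 2, 3, 4 stand for \<open>i\<close>, \<open>n\<close>,
    \<open>m\<close>, \<open>j\<close>, \<open>j'\<close>.\<close>
  have "finite_kernel k (\<lambda>v. v 4 < v 3 \<and> a (v 2 + v 4) \<noteq> a (v 1 + v 4))"
    by (rule map2[where f = "(\<and>)"], rule finite_kernel_less,
        rule map2[where f = "(\<noteq>)"], rule sum, rule sum)
  from finite_kernel_Ex[OF k0 this, of 4]
  have agree: "finite_kernel k (\<lambda>v. \<exists>j'. j' < v 3 \<and> a (v 2 + j') \<noteq> a (v 1 + j'))" by simp
  have alt: "finite_kernel k (\<lambda>v. alt s (v 3))"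
    unfolding alt_def by (rule finite_kernel_map[OF finite_kernel_even])
  have "finite_kernel k (\<lambda>v. alt s (v 3) * a (v 2 + v 3) < alt s (v 3) * a (v 1 + v 3))"
    by (rule map2[where f = "(<)"]; rule map2[where f = "(*)"]; rule alt sum)
  hence "finite_kernel k (\<lambda>v. \<not> v 0 < v 3 \<and> \<not> (\<exists>j'. j' < v 3 \<and> a (v 2 + j') \<noteq> a (v 1 + j')) \<and>
      alt s (v 3) * a (v 2 + v 3) < alt s (v 3) * a (v 1 + v 3))"
    by (intro map2[where f = "(\<and>)"] finite_kernel_map[where f = Not] finite_kernel_less agree)
  from finite_kernel_Ex[OF k0 this, of 3]
  have "finite_kernel k (\<lambda>v. window_less s a (v 0) (v 2) (v 1))"
    by (simp add: window_less_def)
  from finite_kernel_finite[OF k0 this, of 2]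
  have "finite_kernel k (\<lambda>v. finite {m. window_less s a (v 0) m (v 1)})" by simp
  from map2[OF this sum[of 1 0], of "\<lambda>p c. if p then Some c else None"]
  have "finite_kernel k (\<lambda>v. if finite {m. window_less s a (v 0) m (v 1)}
      then Some (a (v 1 + v 0)) else None)" .
  \<comment> \<open>The set of recurrent values may also contain \<open>None\<close>; the preimage
    under \<open>Some\<close> discards it and leaves \<open>{b i}\<close>.\<close>
  from finite_kernel_map[OF finite_kernel_recurrent_values[OF k0 this, of 1],
      of "\<lambda>A. the_elem (Some -` A)"]
  have "finite_kernel k (\<lambda>v. b (v 0))"
    by (simp add: vimage_def least_recurrent_digit[OF lr s] del: One_nat_def cong: if_cong)
  thus ?thesis by (rule finite_kernel_imp_automatic)
qed

section \<open>Continued fractions\<close>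

lemma cf_convergent_ge:
  assumes "\<forall>i\<ge>1. c i \<ge> 1"
  shows "cf_convergent c n \<ge> of_int (c 0)"
  using assms
proof (induction n arbitrary: c)
  case (Suc n)
  have "cf_convergent (\<lambda>i. c (Suc i)) n \<ge> of_int (c 1)"
    using Suc.IH[of "\<lambda>i. c (Suc i)"] Suc.prems by simp
  moreover have "c 1 \<ge> 1" using Suc.prems by simp
  ultimately show ?case by simp
qed simp

lemma cf_convergent_tail_ge_1:
  assumes "\<forall>i\<ge>1. c i \<ge> 1"
  shows "cf_convergent (\<lambda>i. c (Suc i)) n \<ge> 1"
proof -
  have "real_of_int (c 1) \<ge> 1" using assms by simp
  also have "cf_convergent (\<lambda>i. c (Suc i)) n \<ge> of_int (c 1)"
    using cf_convergent_ge[of "\<lambda>i. c (Suc i)" n] assms by simp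
  finally show ?thesis .
qed

text \<open>Two steps are taken because a single reciprocal does not contract uniformly near 1. Here
  both factors \<open>c * u + 1\<close> and \<open>c * v + 1\<close> of the denominator are at least
  2.\<close>

lemma two_step_contraction:
  fixes u v c :: real
  assumes "u \<ge> 1" "v \<ge> 1" "c \<ge> 1"
  shows "\<bar>1 / (c + 1 / u) - 1 / (c + 1 / v)\<bar> \<le> \<bar>u - v\<bar> / 4"
proof -
  have cu: "c * u \<ge> 1" and cv: "c * v \<ge> 1"
    using assms mult_mono[of 1 c 1 u] mult_mono[of 1 c 1 v] by auto
  have "1 / (c + 1 / u) - 1 / (c + 1 / v) = u / (c * u + 1) - v / (c * v + 1)"
    using assms by (simp add: field_simps)
  also have "\<dots> = (u - v) / ((c * u + 1) * (c * v + 1))"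
    using cu cv by (simp add: field_simps)
  also have "\<bar>\<dots>\<bar> = \<bar>u - v\<bar> / ((c * u + 1) * (c * v + 1))"
    using cu cv by (simp add: abs_mult)
  also have "\<dots> \<le> \<bar>u - v\<bar> / 4"
    using mult_mono[of 2 "c * u + 1" 2 "c * v + 1"] cu cv by (intro divide_left_mono) auto
  finally show ?thesis .
qed

lemma cf_convergent_close:
  assumes "\<forall>i\<ge>1. c i \<ge> 1" "\<forall>i\<ge>1. d i \<ge> 1" "\<forall>j<N. c j = d j"
    and "1 \<le> N" "N \<le> m" "N \<le> n"
  shows "\<bar>cf_convergent c m - cf_convergent d n\<bar> \<le> 4 * (1 / 2) ^ N"
  using assms
proof (induction N arbitrary: c d m n rule: less_induct)
  case (less N)
  obtain m' n' where mn: "m = Suc m'" "n = Suc n'"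
    using less.prems by (cases m; cases n) auto
  have c0: "c 0 = d 0" using less.prems by simp
  show ?case
  \<comment> \<open>The induction strips two digits at a time, gaining 1/4. The factor 4 makes the
    bound at least 1 in the base cases, where the difference is at most 1.\<close>
  proof (cases "N \<le> 2")
    case True
    define u v where "u = cf_convergent (\<lambda>i. c (Suc i)) m'" and "v = cf_convergent (\<lambda>i. d (Suc i)) n'"
    have "u \<ge> 1" "v \<ge> 1"
      unfolding u_def v_def using less.prems by (auto intro!: cf_convergent_tail_ge_1)
    hence "0 < 1 / u" "1 / u \<le> 1" "0 < 1 / v" "1 / v \<le> 1" by auto
    hence "\<bar>1 / u - 1 / v\<bar> \<le> 1" by linarith
    hence "\<bar>cf_convergent c m - cf_convergent d n\<bar> \<le> 1"
      by (simp add: mn c0 flip: u_def v_def)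
    moreover have "N = 1 \<or> N = 2" using True less.prems by auto
    ultimately show ?thesis by (auto simp: power2_eq_square)
  next
    case False
    then obtain m'' n'' N' where mn': "m' = Suc m''" "n' = Suc n''" "N = Suc (Suc N')" "N' \<ge> 1"
      using mn less.prems by (cases m'; cases n'; cases N; cases "N - 1") auto
    define u v where "u = cf_convergent (\<lambda>i. c (Suc (Suc i))) m''"
      and "v = cf_convergent (\<lambda>i. d (Suc (Suc i))) n''"
    have "u \<ge> 1" "v \<ge> 1"
      unfolding u_def v_def
      using cf_convergent_tail_ge_1[of "\<lambda>i. c (Suc i)"] cf_convergent_tail_ge_1[of "\<lambda>i. d (Suc i)"]
        less.prems by auto
    moreover have "c 1 = d 1" "d 1 \<ge> 1" using less.prems mn' by auto
    moreover have "\<bar>u - v\<bar> \<le> 4 * (1 / 2) ^ N'"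
      unfolding u_def v_def by (rule less.IH) (use less.prems mn mn' in auto)
    ultimately show ?thesis
      using two_step_contraction[of u v "of_int (d 1)"]
      by (simp add: mn mn' c0 flip: u_def v_def)
  qed
qed

lemma cf_expansion_exists:
  assumes c: "\<forall>i\<ge>1. c i \<ge> 1"
  shows "\<exists>y. cf_expansion y c"
proof -
  have "Cauchy (cf_convergent c)"
  proof (rule metric_CauchyI)
    fix e :: real assume "e > 0"
    then obtain N where N: "(1 / 2) ^ N < e / 4"
      using real_arch_pow_inv[of "e / 4" "1 / 2"] by auto
    have "(1 / 2) ^ Suc N \<le> ((1 / 2) ^ N :: real)" by simp
    hence "4 * (1 / 2) ^ Suc N < e" using N by linarith
    hence "dist (cf_convergent c m) (cf_convergent c n) < e" if "m \<ge> Suc N" "n \<ge> Suc N" for m n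
      using cf_convergent_close[OF c c, of "Suc N" m n] that by (simp add: dist_real_def)
    thus "\<exists>M. \<forall>m\<ge>M. \<forall>n\<ge>M. dist (cf_convergent c m) (cf_convergent c n) < e" by blast
  qed
  thus ?thesis
    using c Cauchy_convergent unfolding convergent_def cf_expansion_def by blast
qed

lemma cf_expansion_close:
  assumes "cf_expansion y c" "cf_expansion z d" "\<forall>j<N. c j = d j" "1 \<le> N"
  shows "\<bar>y - z\<bar> \<le> 4 * (1 / 2) ^ N"
proof (rule LIMSEQ_le_const2)
  show "(\<lambda>n. \<bar>cf_convergent c n - cf_convergent d n\<bar>) \<longlonglongrightarrow> \<bar>y - z\<bar>"
    using assms by (intro tendsto_intros) (auto simp: cf_expansion_def)
  show "\<exists>M. \<forall>n\<ge>M. \<bar>cf_convergent c n - cf_convergent d n\<bar> \<le> 4 * (1 / 2) ^ N"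
    using assms by (intro exI[of _ N] allI impI cf_convergent_close) (auto simp: cf_expansion_def)
qed

lemma cf_expansion_ge:
  assumes "cf_expansion y c"
  shows "y \<ge> of_int (c 0)"
  using assms LIMSEQ_le_const[of "cf_convergent c" y "of_int (c 0)"] cf_convergent_ge[of c]
  unfolding cf_expansion_def by blast

section \<open>Removing the first digit and the Gauss map\<close>

lemma cf_expansion_tail:
  assumes "cf_expansion y c"
  obtains z where "cf_expansion z (\<lambda>i. c (Suc i))" "y = of_int (c 0) + 1 / z" "z \<ge> 1"
proof -
  have c: "\<forall>i\<ge>1. c i \<ge> 1" using assms by (simp add: cf_expansion_def)
  then obtain z where z: "cf_expansion z (\<lambda>i. c (Suc i))"
    using cf_expansion_exists[of "\<lambda>i. c (Suc i)"] by auto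
  have "c 1 \<ge> 1" using c by simp
  with cf_expansion_ge[OF z] have z1: "z \<ge> 1" by simp
  have "(\<lambda>n. of_int (c 0) + 1 / cf_convergent (\<lambda>i. c (Suc i)) n) \<longlonglongrightarrow> of_int (c 0) + 1 / z"
    using z z1 by (intro tendsto_intros) (auto simp: cf_expansion_def)
  moreover have "(\<lambda>n. cf_convergent c (Suc n)) \<longlonglongrightarrow> y"
    using assms LIMSEQ_Suc by (auto simp: cf_expansion_def simp del: cf_convergent.simps)
  ultimately have "y = of_int (c 0) + 1 / z"
    using LIMSEQ_unique by auto
  with z z1 that show ?thesis by blast
qed

lemma cf_expansion_gauss_map:
  assumes "cf_expansion y c"
  shows "cf_expansion (gauss_map y) (\<lambda>i. c (Suc i))"
proof -
  obtain z where z: "cf_expansion z (\<lambda>i. c (Suc i))" "y = of_int (c 0) + 1 / z" "z \<ge> 1"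
    by (rule cf_expansion_tail[OF assms])
  \<comment> \<open>A second tail makes \<open>z > 1\<close> strict, which excludes
    \<open>y = c 0 + 1\<close> and so fixes the floor.\<close>
  obtain z' where z': "z = of_int (c 1) + 1 / z'" "z' \<ge> 1"
    using cf_expansion_tail[OF z(1)] by auto
  have "real_of_int (c 1) \<ge> 1" using assms by (simp add: cf_expansion_def)
  moreover have "1 / z' > 0" using z' by simp
  ultimately have "z > 1" using z' by linarith
  hence "\<lfloor>y\<rfloor> = c 0" using z(2) by (simp add: floor_eq_iff)
  thus ?thesis using z by (simp add: gauss_map_def)
qed

lemma cf_expansion_gauss_map_iterate:
  assumes "cf_expansion x a"
  shows "cf_expansion ((gauss_map ^^ n) x) (\<lambda>i. a (n + i))"
proof (induction n)
  case (Suc n)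
  from cf_expansion_gauss_map[OF this] show ?case by simp
qed (simp add: assms)

text \<open>Removing an equal first digit reverses the order through the reciprocal, which matches
  the change from \<open>s\<close> to \<open>- s\<close> in \<open>alt\<close>. At the first
  difference the integer digits are at least 1 apart, and both fractional terms lie between 0 and
  1.\<close>

lemma cf_expansion_less:
  assumes "cf_expansion y c" "cf_expansion z d" "\<forall>j<i. c j = d j"
    and "alt s i * c i < alt s i * d i" "s = 1 \<or> s = -1"
  shows "of_int s * y \<le> of_int s * z"
  using assms
proof (induction i arbitrary: y z c d s)
  case 0
  obtain y' where y': "y = of_int (c 0) + 1 / y'" "y' \<ge> 1"
    using cf_expansion_tail[OF 0(1)] by auto
  obtain z' where z': "z = of_int (d 0) + 1 / z'" "z' \<ge> 1"
    using cf_expansion_tail[OF 0(2)] by auto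
  have "0 < 1 / y'" "1 / y' \<le> 1" "0 < 1 / z'" "1 / z' \<le> 1" using y' z' by auto
  moreover have "s = 1 \<and> c 0 + 1 \<le> d 0 \<or> s = -1 \<and> d 0 + 1 \<le> c 0"
    using 0 by (auto simp: alt_def)
  hence "s = 1 \<and> real_of_int (c 0) + 1 \<le> of_int (d 0) \<or>
      s = -1 \<and> real_of_int (d 0) + 1 \<le> of_int (c 0)"
    by linarith
  ultimately consider "s = 1" "y \<le> z" | "s = -1" "z \<le> y"
    unfolding y' z' by linarith
  thus ?case by cases simp_all
next
  case (Suc i)
  obtain y' where y': "cf_expansion y' (\<lambda>i. c (Suc i))" "y = of_int (c 0) + 1 / y'" "y' \<ge> 1"
    by (rule cf_expansion_tail[OF Suc.prems(1)])
  obtain z' where z': "cf_expansion z' (\<lambda>i. d (Suc i))" "z = of_int (d 0) + 1 / z'" "z' \<ge> 1"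
    by (rule cf_expansion_tail[OF Suc.prems(2)])
  have "of_int (- s) * y' \<le> of_int (- s) * z'"
    by (rule Suc.IH[OF y'(1) z'(1)]) (use Suc.prems in \<open>auto simp: alt_def split: if_splits\<close>)
  moreover have "c 0 = d 0" using Suc.prems by simp
  ultimately show ?case
    using Suc.prems(5) y' z' by (auto simp: frac_le)
qed

text \<open>Eventually a window either agrees with \<open>b\<close> on \<open>N + 1\<close> digits,
  so the values are close, or first differs by a larger digit, so the value is not below the limit.
  Agreement recurs infinitely often.\<close>

lemma least_recurrent_limit:
  assumes x: "cf_expansion x a" and y: "cf_expansion y b" and lr: "least_recurrent s a b"
    and s: "s = 1 \<or> s = -1" and e: "e > 0"
  shows "\<forall>\<^sub>F n in sequentially. of_int s * y - e < of_int s * (gauss_map ^^ n) x"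
    and "\<exists>\<^sub>F n in sequentially. of_int s * (gauss_map ^^ n) x < of_int s * y + e"
proof -
  note T = cf_expansion_gauss_map_iterate[OF x]
  obtain N where "(1 / 2) ^ N < e / 4"
    using real_arch_pow_inv[of "e / 4" "1 / 2"] e by auto
  moreover have "(1 / 2) ^ Suc N \<le> ((1 / 2) ^ N :: real)" by simp
  ultimately have N: "4 * (1 / 2) ^ Suc N < e" by linarith
  have close: "\<bar>of_int s * (gauss_map ^^ n) x - of_int s * y\<bar> < e" if "\<forall>j<Suc N. a (n + j) = b j" for n
    using cf_expansion_close[OF T y that] N s by auto
  have "\<forall>\<^sub>F n in sequentially.
      \<not> (\<exists>j\<le>N. (\<forall>j'<j. a (n + j') = b j') \<and> alt s j * a (n + j) < alt s j * b j)"
    using least_recurrent_eventually[OF lr, of N]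
    by (simp add: eventually_cofinite flip: cofinite_eq_sequentially)
  thus "\<forall>\<^sub>F n in sequentially. of_int s * y - e < of_int s * (gauss_map ^^ n) x"
  proof eventually_elim
    case (elim n)
    show ?case
    proof (cases "\<forall>j<Suc N. a (n + j) = b j")
      case True
      from close[OF this] show ?thesis by linarith
    next
      case False
      then obtain j0 where j0: "j0 \<le> N" "a (n + j0) \<noteq> b j0"
        by (auto simp: less_Suc_eq_le)
      then obtain j where j: "a (n + j) \<noteq> b j" "\<forall>j'<j. a (n + j') = b j'"
        using exists_least_iff[of "\<lambda>j. a (n + j) \<noteq> b j"] by blast
      have "j \<le> N" using j(2) j0 by (meson le_less_linear le_less_trans order_trans)
      note j = j this
      have nonzero: "alt s j \<noteq> 0" using s by (auto simp: alt_def)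
      have "alt s j * b j < alt s j * a (n + j)"
        using elim j s by (metis linorder_neqE mult_left_cancel nonzero)
      with j s have "of_int s * y \<le> of_int s * (gauss_map ^^ n) x"
        using cf_expansion_less[OF y T, of j n s] by simp
      thus ?thesis using e by simp
    qed
  qed
  have "infinite {n. \<forall>j<Suc N. a (n + j) = b j}"
    using lr unfolding least_recurrent_def by blast
  hence "\<exists>\<^sub>F n in sequentially. \<forall>j<Suc N. a (n + j) = b j"
    by (simp add: frequently_cofinite flip: cofinite_eq_sequentially)
  thus "\<exists>\<^sub>F n in sequentially. of_int s * (gauss_map ^^ n) x < of_int s * y + e"
    by (rule frequently_elim1) (use close in force)
qed

section \<open>Lower and upper limits of the orbit\<close>

lemma liminf_eqI:
  fixes X :: "nat \<Rightarrow> real"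
  assumes "\<And>e. e > 0 \<Longrightarrow> \<forall>\<^sub>F n in sequentially. y - e < X n"
    and "\<And>e. e > 0 \<Longrightarrow> \<exists>\<^sub>F n in sequentially. X n < y + e"
  shows "liminf (\<lambda>n. ereal (X n)) = ereal y"
proof (rule antisym)
  show "ereal y \<le> liminf (\<lambda>n. ereal (X n))"
  proof (rule le_Liminf_iff[THEN iffD2], intro allI impI)
    fix z assume "z < ereal y"
    then obtain r where r: "z < ereal r" "r < y"
      using ereal_dense2 less_ereal.simps(1) by blast
    from assms(1)[of "y - r"] r(2) have "\<forall>\<^sub>F n in sequentially. r < X n" by simp
    thus "\<forall>\<^sub>F n in sequentially. z < ereal (X n)"
      by eventually_elim (use r(1) in \<open>auto intro: less_trans\<close>)
  qed
  show "liminf (\<lambda>n. ereal (X n)) \<le> ereal y"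
  proof (rule ccontr)
    assume "\<not> liminf (\<lambda>n. ereal (X n)) \<le> ereal y"
    then obtain r where r: "ereal y < ereal r" "ereal r < liminf (\<lambda>n. ereal (X n))"
      using ereal_dense2 by (metis not_le)
    hence "\<forall>\<^sub>F n in sequentially. ereal r < ereal (X n)"
      using less_LiminfD by blast
    hence "\<forall>\<^sub>F n in sequentially. \<not> X n < y + (r - y)"
      by eventually_elim simp
    thus False using assms(2)[of "r - y"] r(1) by (simp add: frequently_def)
  qed
qed

lemma automatic_extremal_limit:
  assumes k: "k \<ge> 2" and x: "cf_expansion x a" and a: "automatic_cf k a" and s: "s = 1 \<or> s = -1"
  shows "\<exists>y b. cf_expansion y b \<and> automatic_cf k b \<and>
    liminf (\<lambda>n. ereal (of_int s * (gauss_map ^^ n) x)) = ereal (of_int s * y)"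
proof -
  obtain B where B: "\<And>i. \<bar>a i\<bar> \<le> B" using a by (auto simp: automatic_cf_def)
  have "range a \<subseteq> {-B..B}"
  proof clarify
    fix i show "a i \<in> {-B..B}" using B[of i] by auto
  qed
  hence "finite (range a)" by (rule finite_subset) simp
  then obtain b where b: "least_recurrent s a b" using least_recurrent_exists by blast
  \<comment> \<open>Positions \<open>n \<ge> 1\<close> avoid \<open>a 0\<close>, which need not be
    positive.\<close>
  have occ: "\<exists>n\<ge>1. a n = b i" for i
    using least_recurrent_digit_recurs[OF b, of i] unfolding infinite_nat_iff_unbounded_le by blast
  have "\<forall>i. \<bar>b i\<bar> \<le> B" using occ B by metis
  moreover have "automatic k b"
    by (rule automatic_least_recurrent[OF k _ b]) (use a s in \<open>auto simp: automatic_cf_def\<close>)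
  ultimately have "automatic_cf k b" by (auto simp: automatic_cf_def)
  moreover have "\<forall>i\<ge>1. b i \<ge> 1"
    using occ x unfolding cf_expansion_def by metis
  then obtain y where y: "cf_expansion y b" using cf_expansion_exists by blast
  moreover have "liminf (\<lambda>n. ereal (of_int s * (gauss_map ^^ n) x)) = ereal (of_int s * y)"
    by (rule liminf_eqI) (use least_recurrent_limit[OF x y b s] in auto)
  ultimately show ?thesis by blast
qed

theorem theorem7:
  fixes k :: nat and x :: real and a :: "nat \<Rightarrow> int"
  assumes "k \<ge> 2"
    and "x \<notin> \<rat>"
    and "cf_expansion x a"
    and "automatic_cf k a"
  shows "\<exists>(l::real) (u::real) b c.
           liminf (\<lambda>n. ereal ((gauss_map ^^ n) x)) = ereal l \<and>
           limsup (\<lambda>n. ereal ((gauss_map ^^ n) x)) = ereal u \<and>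
           cf_expansion l b \<and> automatic_cf k b \<and>
           cf_expansion u c \<and> automatic_cf k c"
proof -
  note extremal = automatic_extremal_limit[OF assms(1,3,4)]
  obtain l b where l: "cf_expansion l b" "automatic_cf k b"
    "liminf (\<lambda>n. ereal ((gauss_map ^^ n) x)) = ereal l"
    using extremal[of 1] by auto
  \<comment> \<open>With sign -1 the lower limit of the negated orbit is the negated upper
    limit.\<close>
  obtain u c where u: "cf_expansion u c" "automatic_cf k c"
    "liminf (\<lambda>n. - ereal ((gauss_map ^^ n) x)) = ereal (- u)"
    using extremal[of "-1"] by auto
  have "limsup (\<lambda>n. ereal ((gauss_map ^^ n) x)) = ereal u"
    using u(3) by (simp add: ereal_Liminf_uminus ereal_uminus_eq_reorder del: uminus_ereal.simps) simp
  with l u show ?thesis by blast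
qed

end
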